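(* Run Algorithm PMR (defined in the context) with parameters $\gamma\ge 1$ and $0<R^*<1/2$, and suppose that at the end of the peel-off phase $R\le R^*$. Define $\epsilon$ by $OPT=(1-\epsilon)nW$ and suppose (i) $R^*<1-\frac{6\alpha_{GW}}{3\alpha_{GW}-2}\,\epsilon$, (ii) $\gamma\le (1-R^* )^2\cdot\frac{3\alpha_{GW}-2}{9\alpha_{GW}^2}\cdot\frac{1}{\epsilon}$, (iii) $\frac13\ge R^*\big(\frac{\alpha_{GW}}{2}-\frac16\big)+\gamma(1-\alpha_{GW})$. Then $ALG_P+ALG_C\ge nW\cdot F(R^* )$, where $F(x)=\big(1-\frac{x}{4\gamma}\big)x+\frac23\big(1-\frac{x}{2\gamma}\big)(1-x)$.
   Context: Instance: a finite set $V$ of $n$ items (vertices of $G=(V,E)$) with nonnegative dissimilarity weights $w_{i,j}=w_{j,i}$; $W=\sum_{(i,j)\in E}w_{i,j}$. A hierarchical clustering tree $T$ is a rooted tree with leaf set $V$; $T_{i,j}$ is the subtree rooted at the least common ancestor of $i,j$, $|T_{i,j}|$ its number of leaves; $Rev(T)=\sum_{i,j}w_{i,j}|T_{i,j}|$, and $OPT=\max_TRev(T)$. $\alpha_{GW}\approx 0.8786$ is the approximation ratio of the Goemans–Williamson max-cut algorithm (which returns a cut of expected weight at least $\alpha_{GW}$ times the maximum cut). Random Partitioning: recursively split every cluster of size at least two into two nonempty parts uniformly at random. Algorithm PMR with parameters $\gamma,R^*$: set $V_B\leftarrow V$, $E_B\leftarrow E$. While some $v\in V_B$ has $W_v=\sum_{u\in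 V_B,(v,u)\in E_B}w_{v,u}\ge\gamma\frac{2W}{n}$ (original $W,n$), choose $v^*$ with the largest $W_v$, split the current cluster $V_B$ into $\{v^*\}$ and $V_B\setminus\{v^*\}$, delete $v^*$ from $V_B$ and its incident edges from $E_B$ (peel-off phase). Deleted vertices are red; edges with a red endpoint are red edges, of total weight $W_R$; $R=W_R/W$. If $R>R^*$, run Random Partitioning on $V_B$; otherwise run Goemans–Williamson max-cut on $(V_B,E_B)$, split the cluster $V_B$ into the two sides of the cut, and run Random Partitioning on each side. With $T$ the output, $ALG_P=\sum_{\text{red edges}(i,j)}w_{i,j}|T_{i,j}|$, and (when $R\le R^*$) $ALG_C$ is the expected value of $\sum w_{i,j}|T_{i,j}|$ over the edges of $E_B$ crossing the max-cut step, i.e. $|V_B|$ times the weight of that cut.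
   Formalization: Clustering trees in OPT are taken to be binary: with arbitrary rooted trees the star has revenue nW, so ε would always be 0 and 1/ε in (ii) undefined; condition (ii) is read as vacuous when ε = 0. *)

theory Defs
  imports "HOL-Probability.Probability"
begin

section \<open>Weighted graphs and hierarchical clustering trees\<close>

text \<open>An edge is the two-element set of its endpoints, so that the symmetric weight
  $w_{i,j} = w_{j,i}$ is \<open>w {i, j}\<close> and sums over \<open>E\<close> count every pair once.\<close>

definition weighted_graph :: "'a set \<Rightarrow> 'a set set \<Rightarrow> ('a set \<Rightarrow> real) \<Rightarrow> bool" where
  "weighted_graph V E w \<longleftrightarrow>
     finite V \<and> (\<forall>e\<in>E. e \<subseteq> V \<and> card e = 2) \<and> (\<forall>e\<in>E. 0 \<le> w e)"

definition total_weight :: "'a set set \<Rightarrow> ('a set \<Rightarrow> real) \<Rightarrow> real" where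
  "total_weight E w = (\<Sum>e\<in>E. w e)"

text \<open>Clustering trees are binary. (Without this restriction the star would attain revenue
  \<open>n * W\<close> on every instance.)\<close>

datatype 'a hct = Leaf 'a | Node "'a hct" "'a hct"

fun leaves :: "'a hct \<Rightarrow> 'a list" where
  "leaves (Leaf x) = [x]"
| "leaves (Node l r) = leaves l @ leaves r"

definition hc_tree :: "'a set \<Rightarrow> 'a hct \<Rightarrow> bool" where
  "hc_tree V T \<longleftrightarrow> distinct (leaves T) \<and> set (leaves T) = V"

fun lca_subtree :: "'a hct \<Rightarrow> 'a set \<Rightarrow> 'a hct" where
  "lca_subtree (Leaf x) e = Leaf x"
| "lca_subtree (Node l r) e =
     (if e \<subseteq> set (leaves l) then lca_subtree l e
      else if e \<subseteq> set (leaves r) then lca_subtree r e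
      else Node l r)"

definition lca_size :: "'a hct \<Rightarrow> 'a set \<Rightarrow> nat" where
  "lca_size T e = length (leaves (lca_subtree T e))"

text \<open>Revenue collected on the edge set \<open>F\<close>; $Rev(T)$ is \<open>revenue E w T\<close>.\<close>

definition revenue :: "'a set set \<Rightarrow> ('a set \<Rightarrow> real) \<Rightarrow> 'a hct \<Rightarrow> real" where
  "revenue F w T = (\<Sum>e\<in>F. w e * real (lca_size T e))"

definition OPT :: "'a set \<Rightarrow> 'a set set \<Rightarrow> ('a set \<Rightarrow> real) \<Rightarrow> real" where
  "OPT V E w = Max {revenue E w T |T. hc_tree V T}"

section \<open>Max-cut and the Goemans--Williamson guarantee\<close>

definition cut_edges :: "'a set set \<Rightarrow> 'a set \<Rightarrow> 'a set set" where
  "cut_edges F S = {e \<in> F. e \<inter> S \<noteq> {} \<and> e - S \<noteq> {}}"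

definition cut_weight :: "'a set set \<Rightarrow> ('a set \<Rightarrow> real) \<Rightarrow> 'a set \<Rightarrow> real" where
  "cut_weight F w S = (\<Sum>e\<in>cut_edges F S. w e)"

definition max_cut :: "'a set \<Rightarrow> 'a set set \<Rightarrow> ('a set \<Rightarrow> real) \<Rightarrow> real" where
  "max_cut U F w = Max (cut_weight F w ` Pow U)"

definition alpha_GW :: real where
  "alpha_GW = (INF \<theta>\<in>{0<..pi}. (2 / pi) * (\<theta> / (1 - cos \<theta>)))"

text \<open>The max-cut algorithm enters only through its guarantee: it maps an instance to a random
  cut (the distribution of one side) of expected weight at least \<open>alpha_GW\<close> times the maximum.
  One side of the returned cut may be empty.\<close>

definition gw_algorithm ::
    "('a set \<Rightarrow> 'a set set \<Rightarrow> ('a set \<Rightarrow> real) \<Rightarrow> 'a set pmf) \<Rightarrow> bool" where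
  "gw_algorithm gw \<longleftrightarrow>
     (\<forall>U F w. weighted_graph U F w \<longrightarrow>
        set_pmf (gw U F w) \<subseteq> Pow U \<and>
        measure_pmf.expectation (gw U F w) (cut_weight F w) \<ge> alpha_GW * max_cut U F w)"

section \<open>Random Partitioning\<close>

text \<open>A uniformly random ordered split \<open>(S, U - S)\<close> into nonempty parts induces a uniformly
  random unordered one.\<close>

function random_partitioning :: "'a set \<Rightarrow> 'a hct pmf" where
  "random_partitioning U =
     (if card U < 2 then return_pmf (Leaf (the_elem U))
      else bind_pmf (pmf_of_set {S. S \<noteq> {} \<and> S \<subset> U}) (\<lambda>S.
             bind_pmf (random_partitioning S) (\<lambda>l.
               bind_pmf (random_partitioning (U - S)) (\<lambda>r.
                 return_pmf (Node l r)))))"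
  by pat_completeness auto

lemma random_partitioning_split:
  assumes "\<not> card U < 2" and "S \<in> set_pmf (pmf_of_set {S. S \<noteq> {} \<and> S \<subset> U})"
  shows "card S < card U" and "card (U - S) < card U"
proof -
  have fin: "finite U"
    using assms(1) by (metis card.infinite zero_less_numeral)
  then obtain x where "x \<in> U"
    using assms(1) by fastforce
  moreover have "{x} \<noteq> U"
    using assms(1) by auto
  ultimately have "{S. S \<noteq> {} \<and> S \<subset> U} \<noteq> {}"
    by blast
  moreover have "finite {S. S \<noteq> {} \<and> S \<subset> U}"
    by (rule finite_subset[of _ "Pow U"]) (use fin in auto)
  ultimately have "S \<in> {S. S \<noteq> {} \<and> S \<subset> U}"
    using assms(2) by (metis (no_types) set_pmf_of_set)
  then have S: "S \<noteq> {}" "S \<subset> U"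
    by auto
  show "card S < card U"
    using fin S by (intro psubset_card_mono)
  show "card (U - S) < card U"
    using fin S by (intro psubset_card_mono) auto
qed

termination random_partitioning
  by (relation "Wellfounded.measure card") (use random_partitioning_split in auto)

declare random_partitioning.simps [simp del]

section \<open>Algorithm PMR\<close>

definition incident_weight :: "'a set set \<Rightarrow> ('a set \<Rightarrow> real) \<Rightarrow> 'a \<Rightarrow> real" where
  "incident_weight F w v = (\<Sum>e\<in>{e \<in> F. v \<in> e}. w e)"

definition peel_threshold :: "'a set \<Rightarrow> 'a set set \<Rightarrow> ('a set \<Rightarrow> real) \<Rightarrow> real \<Rightarrow> real" where
  "peel_threshold V E w \<gamma> = \<gamma> * (2 * total_weight E w / real (card V))"

text \<open>\<open>peeling V E w \<gamma> vs VB EB\<close>: the loop can reach the state \<open>(VB, EB)\<close> after peeling the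
  vertices \<open>vs\<close>, listed in the order of their removal. Ties for the largest \<open>W\<^sub>v\<close> are broken
  arbitrarily.\<close>

inductive peeling ::
    "'a set \<Rightarrow> 'a set set \<Rightarrow> ('a set \<Rightarrow> real) \<Rightarrow> real \<Rightarrow> 'a list \<Rightarrow> 'a set \<Rightarrow> 'a set set \<Rightarrow> bool"
  for V :: "'a set" and E :: "'a set set" and w :: "'a set \<Rightarrow> real" and \<gamma> :: real
where
  peel_start: "peeling V E w \<gamma> [] V E"
| peel_step:
    "\<lbrakk> peeling V E w \<gamma> vs VB EB;
       v \<in> VB;
       incident_weight EB w v \<ge> peel_threshold V E w \<gamma>;
       \<forall>u\<in>VB. incident_weight EB w u \<le> incident_weight EB w v \<rbrakk>
     \<Longrightarrow> peeling V E w \<gamma> (vs @ [v]) (VB - {v}) {e \<in> EB. v \<notin> e}"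

definition peel_off ::
    "'a set \<Rightarrow> 'a set set \<Rightarrow> ('a set \<Rightarrow> real) \<Rightarrow> real \<Rightarrow> 'a list \<Rightarrow> 'a set \<Rightarrow> 'a set set \<Rightarrow> bool" where
  "peel_off V E w \<gamma> vs VB EB \<longleftrightarrow>
     peeling V E w \<gamma> vs VB EB \<and>
     \<not> (\<exists>v\<in>VB. incident_weight EB w v \<ge> peel_threshold V E w \<gamma>)"

text \<open>The fraction \<open>R\<close> of red weight; the red edges are those in \<open>E - EB\<close>.\<close>

definition red_fraction :: "'a set set \<Rightarrow> 'a set set \<Rightarrow> ('a set \<Rightarrow> real) \<Rightarrow> real" where
  "red_fraction E EB w = total_weight (E - EB) w / total_weight E w"

text \<open>The caterpillar built by the peel-off phase, with the tree \<open>T\<close> of the remaining cluster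
  at its bottom.\<close>

definition attach_peeled :: "'a list \<Rightarrow> 'a hct \<Rightarrow> 'a hct" where
  "attach_peeled vs T = foldr (\<lambda>v t. Node (Leaf v) t) vs T"

text \<open>The tree built on \<open>U\<close> by first splitting it into \<open>S\<close> and \<open>U - S\<close>; a cut with an empty
  side causes no split.\<close>

definition split_and_partition :: "'a set \<Rightarrow> 'a set \<Rightarrow> 'a hct pmf" where
  "split_and_partition U S =
     (if S = {} \<or> S = U then random_partitioning U
      else bind_pmf (random_partitioning S) (\<lambda>l.
             bind_pmf (random_partitioning (U - S)) (\<lambda>r.
               return_pmf (Node l r))))"

text \<open>The joint distribution of the side of the max-cut step (\<open>None\<close> if that step is not
  performed) and the output tree, given the result \<open>vs, VB, EB\<close> of the peel-off phase.\<close>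

definition PMR_output ::
    "('a set \<Rightarrow> 'a set set \<Rightarrow> ('a set \<Rightarrow> real) \<Rightarrow> 'a set pmf) \<Rightarrow> 'a set set \<Rightarrow> ('a set \<Rightarrow> real) \<Rightarrow>
     real \<Rightarrow> 'a list \<Rightarrow> 'a set \<Rightarrow> 'a set set \<Rightarrow> ('a set option \<times> 'a hct) pmf" where
  "PMR_output gw E w Rstar vs VB EB =
     (if red_fraction E EB w > Rstar
      then map_pmf (\<lambda>T. (None, attach_peeled vs T)) (random_partitioning VB)
      else bind_pmf (gw VB EB w) (\<lambda>S.
             map_pmf (\<lambda>T. (Some S, attach_peeled vs T)) (split_and_partition VB S)))"

definition ALG_P :: "'a set set \<Rightarrow> 'a set set \<Rightarrow> ('a set \<Rightarrow> real) \<Rightarrow> 'a hct \<Rightarrow> real" where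
  "ALG_P E EB w T = revenue (E - EB) w T"

definition ALG_C ::
    "'a set set \<Rightarrow> ('a set \<Rightarrow> real) \<Rightarrow> ('a set option \<times> 'a hct) pmf \<Rightarrow> real" where
  "ALG_C EB w out =
     measure_pmf.expectation out
       (\<lambda>(c, T). case c of None \<Rightarrow> 0 | Some S \<Rightarrow> revenue (cut_edges EB S) w T)"

definition F_PMR :: "real \<Rightarrow> real \<Rightarrow> real" where
  "F_PMR \<gamma> x = (1 - x / (4 * \<gamma>)) * x + 2 / 3 * (1 - x / (2 * \<gamma>)) * (1 - x)"

end

theory Submission
  imports Defs
begin

text \<open>Normalise \<open>W = 1\<close> and put \<open>\<alpha> = alpha_GW\<close>, \<open>\<Lambda> = (3 * \<alpha> - 2) / (3 * \<alpha>) * (1 - Rstar)\<close> and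
  \<open>B = 1 - R\<close>, the weight of \<open>EB\<close>. The key step is that \<open>(VB, EB)\<close> has a cut of weight at least
  \<open>B - \<Lambda>\<close>. Descend in an optimal tree from the root to the larger child, and let \<open>x\<close> be the weight of
  the edges of \<open>EB\<close> not inside the current cluster \<open>C\<close>. These edges touch \<open>V - C\<close>, where
  degrees are at most \<open>2 * \<gamma> / n\<close>, so \<open>1 - card C / n \<ge> x / (2 * \<gamma>)\<close>; the remaining weight
  \<open>B - x\<close> loses at least this fraction of its revenue, so \<open>x * (B - x) \<le> 2 * \<gamma> * \<epsilon> \<le> \<Lambda> * (B - \<Lambda>)\<close>.
  Hence \<open>x\<close> jumps from \<open>[0, \<Lambda>]\<close> to \<open>[B - \<Lambda>, B]\<close> at a single split of some cluster into \<open>A\<close>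
  and \<open>D\<close>. Separating \<open>A\<close> from \<open>D\<close> and placing the other vertices greedily is the required cut.

  The peeled vertices earn at least \<open>n * R * (1 - R / (4 * \<gamma>))\<close>, because the weights at removal
  decrease, and the cut earns at least \<open>\<alpha> * (B - \<Lambda>) * card VB\<close>. The sum of the two bounds is
  convex in \<open>R\<close>, decreasing on \<open>R \<le> Rstar\<close> by condition (iii), and equals \<open>F_PMR \<gamma> Rstar\<close> at
  \<open>R = Rstar\<close>.\<close>

section \<open>The constant of Goemans and Williamson\<close>

text \<open>With \<open>\<theta> = 2 * x\<close> the function is
  \<open>(2 / pi) * x / (sin x)\<^sup>2\<close>, so \<open>(sin x)\<^sup>2 \<le> 9 / 10 * x\<close>
  suffices for the lower bound, as \<open>153 / 250 * pi < 2\<close>; the upper bound is the value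
  at \<open>pi\<close>. The constant 17/25 exceeds 2/3 so that strictness survives the
  infimum.\<close>

lemma alpha_GW_bounds: "2 / 3 < alpha_GW" "alpha_GW \<le> 1"
proof -
  have lower: "17 / 25 \<le> (2 / pi) * (\<theta> / (1 - cos \<theta>))" if \<theta>: "\<theta> \<in> {0<..pi}" for \<theta> :: real
  proof -
    define x where "x = \<theta> / 2"
    have x: "0 < x" "x \<le> pi / 2" using \<theta> by (auto simp: x_def)
    have "cos \<theta> = 1 - 2 * (sin x)\<^sup>2"
      using cos_double_sin[of x] by (simp add: x_def)
    then have cos: "1 - cos \<theta> = 2 * (sin x)\<^sup>2" by simp
    have s0: "0 < sin x" using x pi_gt_zero by (intro sin_gt_zero) auto
    have "sin x \<le> x" using x by (intro sin_x_le_x) auto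
    then have sx: "(sin x)\<^sup>2 \<le> x\<^sup>2" using s0 by (intro power_mono) auto
    have "sin (x / 2) \<le> x / 2" using x by (intro sin_x_le_x) auto
    moreover have "0 \<le> sin (x / 2)" using x by (intro sin_ge_zero) auto
    ultimately have "(sin (x / 2))\<^sup>2 \<le> (x / 2)\<^sup>2" by (intro power_mono) auto
    then have cx: "1 - x\<^sup>2 / 2 \<le> cos x"
      using cos_double_sin[of "x / 2"] by (simp add: power_divide)
    have "(sin x)\<^sup>2 \<le> 9 / 10 * x"
    \<comment> \<open>\<open>sin x \<le> x\<close> settles small \<open>x\<close> and
      \<open>sin x \<le> 1\<close> settles large \<open>x\<close>; the gap around 1 needs the finer
      bound \<open>1 - x\<^sup>2 / 2 \<le> cos x\<close>.\<close>
    proof (cases "x \<le> 9 / 10 \<or> 10 / 9 \<le> x")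
      case True
      then show ?thesis
      proof
        assume "x \<le> 9 / 10"
        then have "x * x \<le> 9 / 10 * x" using x by (intro mult_right_mono) auto
        with sx show ?thesis by (simp add: power2_eq_square)
      next
        assume "10 / 9 \<le> x"
        moreover have "(sin x)\<^sup>2 \<le> 1" by (simp add: abs_square_le_1)
        ultimately show ?thesis by simp
      qed
    next
      case False
      then have x_range: "9 / 10 \<le> x" "x \<le> 10 / 9" by auto
      have "x\<^sup>2 \<le> (10 / 9)\<^sup>2" using x x_range by (intro power_mono) auto
      then have "0 \<le> 1 - x\<^sup>2 / 2" by (simp add: power2_eq_square)
      then have "(1 - x\<^sup>2 / 2)\<^sup>2 \<le> (cos x)\<^sup>2" using cx by (intro power_mono) auto
      then have "(sin x)\<^sup>2 \<le> x * (1 - x\<^sup>2 / 4) * x"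
        unfolding sin_squared_eq by (simp add: power2_eq_square algebra_simps)
      also have "x * (1 - x\<^sup>2 / 4) \<le> 10 / 9 * (1 - (9 / 10)\<^sup>2 / 4)"
      proof (rule mult_mono)
        have "(9 / 10)\<^sup>2 \<le> x\<^sup>2" using x_range by (intro power_mono) auto
        then show "1 - x\<^sup>2 / 4 \<le> 1 - (9 / 10)\<^sup>2 / 4" by simp
        show "0 \<le> 1 - x\<^sup>2 / 4" using \<open>0 \<le> 1 - x\<^sup>2 / 2\<close> by simp
      qed (use x_range in auto)
      then have "x * (1 - x\<^sup>2 / 4) * x \<le> 9 / 10 * x"
        using x by (intro mult_right_mono) (auto simp: power2_eq_square)
      finally show ?thesis .
    qed
    then have "17 / 25 * pi * (sin x)\<^sup>2 \<le> 17 / 25 * pi * (9 / 10 * x)"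
      by (intro mult_left_mono) auto
    also have "\<dots> = 153 / 250 * pi * x" by simp
    also have "\<dots> \<le> 2 * x"
      using x pi_approx by (intro mult_right_mono) auto
    finally have "17 / 25 * pi * (sin x)\<^sup>2 \<le> \<theta>" by (simp add: x_def)
    then show ?thesis using s0 pi_gt_zero unfolding cos by (simp add: field_simps)
  qed
  have "17 / 25 \<le> alpha_GW" unfolding alpha_GW_def
    using lower pi_gt_zero by (intro cINF_greatest) auto
  then show "2 / 3 < alpha_GW" by simp
  have "alpha_GW \<le> (2 / pi) * (pi / (1 - cos pi))" unfolding alpha_GW_def
    using lower pi_gt_zero by (intro cINF_lower bdd_belowI2[where m = "17 / 25"]) auto
  then show "alpha_GW \<le> 1" by simp
qed

section \<open>Clustering trees\<close>

lemma lca_size_le: "lca_size T e \<le> length (leaves T)"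
  unfolding lca_size_def by (induction T) auto

text \<open>\<open>OPT\<close> is a \<open>Max\<close>, so the set of revenues must be finite and
  nonempty. It is finite because a revenue depends only on \<open>lca_size T\<close> restricted to
  \<open>E\<close>, a function into \<open>{..card V}\<close>.\<close>

lemma OPT_attained:
  assumes graph: "weighted_graph V E w" and "V \<noteq> {}"
  obtains T where "hc_tree V T" "OPT V E w = revenue E w T"
proof -
  have fin: "finite V" "finite E"
    using graph by (auto simp: weighted_graph_def intro: finite_subset[of E "Pow V"])
  have len: "length (leaves T) = card V" if "hc_tree V T" for T
    using that by (metis hc_tree_def distinct_card)
  have "\<exists>T. hc_tree V T"
    using fin(1) \<open>V \<noteq> {}\<close>
  proof (induction rule: finite_ne_induct)
    case (singleton x)
    then show ?case by (intro exI[of _ "Leaf x"]) (simp add: hc_tree_def)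
  next
    case (insert x F)
    then obtain T where "hc_tree F T" by blast
    with insert show ?case by (intro exI[of _ "Node (Leaf x) T"]) (simp add: hc_tree_def)
  qed
  then have ne: "{revenue E w T |T. hc_tree V T} \<noteq> {}" by blast
  have "{revenue E w T |T. hc_tree V T}
          \<subseteq> (\<lambda>g. \<Sum>e\<in>E. w e * real (g e)) ` PiE E (\<lambda>_. {..card V})"
  proof clarify
    fix T assume T: "hc_tree V T"
    have "revenue E w T = (\<Sum>e\<in>E. w e * real (restrict (lca_size T) E e))"
      by (simp add: revenue_def)
    moreover have "restrict (lca_size T) E \<in> PiE E (\<lambda>_. {..card V})"
      using lca_size_le[of T] len[OF T] by auto
    ultimately show "revenue E w T
        \<in> (\<lambda>g. \<Sum>e\<in>E. w e * real (g e)) ` PiE E (\<lambda>_. {..card V})" by blast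
  qed
  then have "finite {revenue E w T |T. hc_tree V T}"
    by (rule finite_subset) (use fin in \<open>auto intro!: finite_PiE\<close>)
  from Max_in[OF this ne] that show ?thesis unfolding OPT_def by auto
qed

lemma revenue_Un:
  "finite F \<Longrightarrow> finite F' \<Longrightarrow> F \<inter> F' = {} \<Longrightarrow> revenue (F \<union> F') w T = revenue F w T + revenue F' w T"
  unfolding revenue_def by (rule sum.union_disjoint)

lemma attach_peeled_simps [simp]:
  "attach_peeled [] T = T"
  "attach_peeled (v # vs) T = Node (Leaf v) (attach_peeled vs T)"
  by (simp_all add: attach_peeled_def)

lemma leaves_attach_peeled [simp]: "leaves (attach_peeled vs T) = vs @ leaves T"
  by (induction vs) auto

lemma lca_size_attach_peeled:
  assumes "e \<subseteq> set (leaves T)" "card e = 2"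
  shows "lca_size (attach_peeled vs T) e = lca_size T e"
proof -
  have "\<not> e \<subseteq> {v}" for v
    using assms(2) card_mono[of "{v}" e] by auto
  then show ?thesis using assms(1)
    by (induction vs) (auto simp: lca_size_def)
qed

lemma lca_size_Node_split:
  assumes "\<not> e \<subseteq> set (leaves l)" "\<not> e \<subseteq> set (leaves r)"
  shows "lca_size (Node l r) e = length (leaves l) + length (leaves r)"
  using assms by (simp add: lca_size_def)

lemma random_partitioning_hc_tree:
  assumes "T \<in> set_pmf (random_partitioning U)" "finite U" "U \<noteq> {}"
  shows "hc_tree U T"
  using assms
proof (induction U arbitrary: T rule: random_partitioning.induct)
  case (1 U)
  show ?case
  proof (cases "card U < 2")
    case True
    moreover have "card U \<noteq> 0" using 1(4,5) by simp
    ultimately have "card U = 1" by simp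
    then obtain x where "U = {x}" by (auto simp: card_1_singleton_iff)
    moreover have "T = Leaf (the_elem U)"
      using 1(3) True by (subst (asm) random_partitioning.simps) simp
    ultimately show ?thesis by (simp add: hc_tree_def)
  next
    case False
    let ?P = "{S. S \<noteq> {} \<and> S \<subset> U}"
    obtain x where x: "x \<in> U" using 1(5) by blast
    moreover have "{x} \<noteq> U" using False by auto
    \<comment> \<open>\<open>pmf_of_set\<close> has the intended support only on finite nonempty
      sets; \<open>{x}\<close> witnesses that a split exists.\<close>
    ultimately have "{x} \<in> ?P" by blast
    then have P: "finite ?P" "?P \<noteq> {}"
      using finite_subset[of ?P "Pow U"] 1(4) by blast+
    obtain S l r where *: "S \<in> set_pmf (pmf_of_set ?P)"
      "l \<in> set_pmf (random_partitioning S)" "r \<in> set_pmf (random_partitioning (U - S))"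
      "T = Node l r"
      using 1(3) False by (subst (asm) random_partitioning.simps) auto
    have S: "S \<noteq> {}" "S \<subset> U" using *(1) P by (simp_all add: set_pmf_of_set)
    have "finite S" using S 1(4) finite_subset by blast
    then have "hc_tree S l" by (rule 1(1)[OF False *(1,2)]) (rule S)
    moreover have "hc_tree (U - S) r"
      by (rule 1(2)[OF False *(1,2,3)]) (use S 1(4) in blast)+
    ultimately show ?thesis using *(4) S by (auto simp: hc_tree_def)
  qed
qed

lemma split_and_partition_hc_tree:
  assumes "T \<in> set_pmf (split_and_partition U S)" "finite U" "U \<noteq> {}" "S \<subseteq> U"
  shows "hc_tree U T"
proof (cases "S = {} \<or> S = U")
  case True
  with assms show ?thesis by (simp add: split_and_partition_def random_partitioning_hc_tree)
next
  case False
  with assms(1) obtain l r where lr: "T = Node l r" "l \<in> set_pmf (random_partitioning S)"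
    "r \<in> set_pmf (random_partitioning (U - S))"
    by (auto simp: split_and_partition_def)
  have "hc_tree S l" using lr(2) False assms(2,4) finite_subset
    by (intro random_partitioning_hc_tree) auto
  moreover have "hc_tree (U - S) r" using lr(3) False assms(2,4)
    by (intro random_partitioning_hc_tree) auto
  ultimately show ?thesis using lr(1) assms(4) by (auto simp: hc_tree_def)
qed

section \<open>Large cuts from good clustering trees\<close>

text \<open>Double counting: each edge of \<open>F\<close> appears on the right at least once, at an
  endpoint in \<open>X\<close>.\<close>

lemma sum_le_sum_incident_weight:
  assumes "finite F" "finite X" "\<And>e. e \<in> F \<Longrightarrow> 0 \<le> w e" "\<And>e. e \<in> F \<Longrightarrow> e \<inter> X \<noteq> {}"
  shows "(\<Sum>e\<in>F. w e) \<le> (\<Sum>v\<in>X. incident_weight F w v)"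
proof -
  have "(\<Sum>e\<in>F. w e) \<le> (\<Sum>e\<in>F. \<Sum>v\<in>X. if v \<in> e then w e else 0)"
  proof (rule sum_mono)
    fix e assume e: "e \<in> F"
    then obtain v where "v \<in> e" "v \<in> X" using assms(4) by blast
    have "(if v \<in> e then w e else 0) \<le> (\<Sum>v\<in>X. if v \<in> e then w e else 0)"
      using \<open>v \<in> X\<close> assms e by (intro member_le_sum) auto
    then show "w e \<le> (\<Sum>v\<in>X. if v \<in> e then w e else 0)" using \<open>v \<in> e\<close> by simp
  qed
  also have "\<dots> = (\<Sum>v\<in>X. \<Sum>e\<in>F. if v \<in> e then w e else 0)" by (rule sum.swap)
  also have "\<dots> = (\<Sum>v\<in>X. incident_weight F w v)"
    unfolding incident_weight_def using assms(1)
    by (simp add: sum.inter_filter)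
  finally show ?thesis .
qed

lemma incident_weight_mono:
  assumes "finite F" "F' \<subseteq> F" "\<And>e. e \<in> F \<Longrightarrow> 0 \<le> w e"
  shows "incident_weight F' w v \<le> incident_weight F w v"
  unfolding incident_weight_def using assms by (intro sum_mono2) auto

lemma cut_weight_eq_sum_if:
  "finite F \<Longrightarrow> cut_weight F w S = (\<Sum>e\<in>F. if e \<inter> S \<noteq> {} \<and> e - S \<noteq> {} then w e else 0)"
  by (simp add: cut_weight_def cut_edges_def sum.inter_filter)

text \<open>The vertices of \<open>H\<close> are added one at a time, each on the side that cuts at least half of
  its edges to the vertices placed before.\<close>

lemma exists_cut_extending:
  assumes "finite H" "finite F" "A \<inter> B = {}" "(A \<union> B) \<inter> H = {}"
    and "\<And>e. e \<in> F \<Longrightarrow> e \<subseteq> A \<union> B \<union> H \<and> card e = 2" "\<And>e. e \<in> F \<Longrightarrow> 0 \<le> w e"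
  shows "\<exists>S. A \<subseteq> S \<and> S \<subseteq> A \<union> H \<and>
    (\<Sum>e\<in>{e\<in>F. e \<inter> A \<noteq> {} \<and> e \<inter> B \<noteq> {}}. w e) + (\<Sum>e\<in>{e\<in>F. e \<inter> H \<noteq> {}}. w e) / 2
      \<le> cut_weight F w S"
  using assms
proof (induction H arbitrary: F rule: finite_induct)
  case empty
  then have "{e\<in>F. e \<inter> A \<noteq> {} \<and> e \<inter> B \<noteq> {}} \<subseteq> cut_edges F A"
    by (auto simp: cut_edges_def)
  moreover have "finite (cut_edges F A)" using empty by (simp add: cut_edges_def)
  ultimately have "(\<Sum>e\<in>{e\<in>F. e \<inter> A \<noteq> {} \<and> e \<inter> B \<noteq> {}}. w e) \<le> cut_weight F w A"
    unfolding cut_weight_def using empty by (intro sum_mono2) (auto simp: cut_edges_def)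
  then show ?case by (intro exI[of _ A]) simp
next
  case (insert h H)
  define F' where "F' = {e\<in>F. h \<notin> e}"
  define Fh where "Fh = {e\<in>F. h \<in> e}"
  have F: "F = F' \<union> Fh" "F' \<inter> Fh = {}" "finite F'" "finite Fh"
    using insert.prems(1) by (auto simp: F'_def Fh_def)
  have "\<exists>S. A \<subseteq> S \<and> S \<subseteq> A \<union> H \<and>
    (\<Sum>e\<in>{e\<in>F'. e \<inter> A \<noteq> {} \<and> e \<inter> B \<noteq> {}}. w e) + (\<Sum>e\<in>{e\<in>F'. e \<inter> H \<noteq> {}}. w e) / 2
      \<le> cut_weight F' w S"
  proof (rule insert.IH)
    show "(A \<union> B) \<inter> H = {}" using insert.prems(3) by blast
    show "e \<subseteq> A \<union> B \<union> H \<and> card e = 2" if "e \<in> F'" for e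
      using insert.prems(4)[of e] that unfolding F'_def by blast
    show "finite F'" "A \<inter> B = {}" using F(3) insert.prems(2) by auto
    show "0 \<le> w e" if "e \<in> F'" for e using insert.prems(5)[of e] that by (simp add: F'_def)
  qed
  then obtain S where S: "A \<subseteq> S" "S \<subseteq> A \<union> H" and cut:
    "(\<Sum>e\<in>{e\<in>F'. e \<inter> A \<noteq> {} \<and> e \<inter> B \<noteq> {}}. w e) + (\<Sum>e\<in>{e\<in>F'. e \<inter> H \<noteq> {}}. w e) / 2
      \<le> cut_weight F' w S" by (elim exE conjE)
  have hS: "h \<notin> S" using S insert.hyps(2) insert.prems(3) by blast
  have cw: "cut_weight F w S' = cut_weight F' w S' + cut_weight Fh w S'" for S'
    using F insert.prems by (simp add: cut_weight_eq_sum_if sum.union_disjoint)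
  have F'S: "cut_weight F' w (insert h S) = cut_weight F' w S"
  proof -
    have "cut_edges F' (insert h S) = cut_edges F' S" by (auto simp: cut_edges_def F'_def)
    then show ?thesis by (simp add: cut_weight_def)
  qed
  \<comment> \<open>The other endpoint of an edge at \<open>h\<close> already has a side, so exactly
    one of the two positions of \<open>h\<close> cuts the edge.\<close>
  have "cut_weight Fh w S + cut_weight Fh w (insert h S) = (\<Sum>e\<in>Fh. w e)"
    unfolding cut_weight_eq_sum_if[OF F(4)] sum.distrib[symmetric]
  proof (rule sum.cong)
    fix e assume "e \<in> Fh"
    then have e: "h \<in> e" "card e = 2" using insert.prems(4)[of e] by (simp_all add: Fh_def)
    then have "card (e - {h}) = 1" by simp
    then obtain u where "e - {h} = {u}" by (rule card_1_singletonE)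
    then have "e = {h, u}" "u \<noteq> h" using e(1) by blast+
    then show "(if e \<inter> S \<noteq> {} \<and> e - S \<noteq> {} then w e else 0) +
        (if e \<inter> insert h S \<noteq> {} \<and> e - insert h S \<noteq> {} then w e else 0) = w e"
      using hS by auto
  qed simp
  then consider "(\<Sum>e\<in>Fh. w e) / 2 \<le> cut_weight Fh w S"
    | "(\<Sum>e\<in>Fh. w e) / 2 \<le> cut_weight Fh w (insert h S)" by linarith
  then obtain S' where S': "S' \<in> {S, insert h S}" "(\<Sum>e\<in>Fh. w e) / 2 \<le> cut_weight Fh w S'"
    by blast
  have "{e\<in>F. e \<inter> insert h H \<noteq> {}} = {e\<in>F'. e \<inter> H \<noteq> {}} \<union> Fh"
    by (auto simp: F'_def Fh_def)
  moreover have "{e\<in>F'. e \<inter> H \<noteq> {}} \<inter> Fh = {}" using F by auto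
  ultimately have "(\<Sum>e\<in>{e\<in>F. e \<inter> insert h H \<noteq> {}}. w e)
      = (\<Sum>e\<in>{e\<in>F'. e \<inter> H \<noteq> {}}. w e) + (\<Sum>e\<in>Fh. w e)"
    using F by (simp add: sum.union_disjoint)
  moreover have "{e\<in>F. e \<inter> A \<noteq> {} \<and> e \<inter> B \<noteq> {}} = {e\<in>F'. e \<inter> A \<noteq> {} \<and> e \<inter> B \<noteq> {}}"
  proof -
    \<comment> \<open>An edge meeting both \<open>A\<close> and \<open>B\<close> has no third
      endpoint left for \<open>h\<close>.\<close>
    have "h \<notin> e" if e: "e \<in> F" "e \<inter> A \<noteq> {}" "e \<inter> B \<noteq> {}" for e
    proof
      assume "h \<in> e"
      from e obtain a b where ab: "a \<in> e" "a \<in> A" "b \<in> e" "b \<in> B" by blast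
      then have "a \<noteq> b" "h \<noteq> a" "h \<noteq> b" using insert.prems(2,3) by auto
      then have "card {h, a, b} = 3" by simp
      moreover have "card {h, a, b} \<le> card e"
        using ab \<open>h \<in> e\<close> insert.prems(4)[OF e(1)] by (intro card_mono) (auto intro: card_ge_0_finite)
      ultimately show False using insert.prems(4)[OF e(1)] by simp
    qed
    then show ?thesis by (auto simp: F'_def)
  qed
  moreover have "cut_weight F w S' = cut_weight F' w S + cut_weight Fh w S'"
    using S'(1) cw F'S by auto
  ultimately have "(\<Sum>e\<in>{e\<in>F. e \<inter> A \<noteq> {} \<and> e \<inter> B \<noteq> {}}. w e)
      + (\<Sum>e\<in>{e\<in>F. e \<inter> insert h H \<noteq> {}}. w e) / 2 \<le> cut_weight F w S'"
    using cut S'(2) by (simp add: field_simps)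
  moreover have "A \<subseteq> S'" "S' \<subseteq> A \<union> insert h H" using S S' by auto
  ultimately show ?case by blast
qed

text \<open>Move from the root to the child with more leaves while that child satisfies
  \<open>P\<close>. As \<open>P\<close> fails on singletons, the descent stops at a node whose
  larger child \<open>A\<close> violates \<open>P\<close>. A nonempty set inside a cluster of the
  tree has its least common ancestor there, which bounds \<open>lca_size\<close>.\<close>

lemma tree_descent:
  assumes "distinct (leaves t)" "P (set (leaves t))" "\<And>x. \<not> P {x}"
  shows "\<exists>A B. A \<union> B \<subseteq> set (leaves t) \<and> A \<inter> B = {} \<and> card B \<le> card A \<and> P (A \<union> B) \<and> \<not> P A \<and>
    (\<forall>X\<in>{A, B, A \<union> B}. \<forall>e. e \<noteq> {} \<longrightarrow> e \<subseteq> X \<longrightarrow> lca_size t e \<le> card X)"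
  using assms(1,2)
proof (induction t)
  case (Leaf x)
  then show ?case using assms(3) by simp
next
  case (Node l r)
  let ?L = "set (leaves l)" and ?R = "set (leaves r)"
  have disj: "?L \<inter> ?R = {}" and dist: "distinct (leaves l)" "distinct (leaves r)"
    using Node.prems by auto
  have card: "length (leaves l) = card ?L" "length (leaves r) = card ?R"
    using dist by (simp_all add: distinct_card)
  have lca_l: "lca_size (Node l r) e = lca_size l e" if "e \<subseteq> ?L" for e
    using that by (simp add: lca_size_def)
  \<comment> \<open>\<open>lca_subtree\<close> tests the left child first, so the empty set would
    always be sent left.\<close>
  have lca_r: "lca_size (Node l r) e = lca_size r e" if "e \<noteq> {}" "e \<subseteq> ?R" for e
  proof -
    have "\<not> e \<subseteq> ?L" using that disj by blast
    with that show ?thesis by (simp add: lca_size_def)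
  qed
  have bound_l: "lca_size (Node l r) e \<le> card ?L" if "e \<subseteq> ?L" for e
    using lca_l[OF that] lca_size_le[of l e] card by simp
  have bound_r: "lca_size (Node l r) e \<le> card ?R" if "e \<noteq> {}" "e \<subseteq> ?R" for e
    using lca_r[OF that] lca_size_le[of r e] card by simp
  have bound: "lca_size (Node l r) e \<le> card (?L \<union> ?R)" for e
    using lca_size_le[of "Node l r" e] card disj by (simp add: card_Un_disjoint)
  consider "card ?R \<le> card ?L" "P ?L" | "card ?R \<le> card ?L" "\<not> P ?L"
    | "card ?L \<le> card ?R" "P ?R" | "card ?L \<le> card ?R" "\<not> P ?R" by linarith
  then show ?case
  proof cases
    case 1
    from Node.IH(1)[OF dist(1) 1(2)] obtain A B where AB: "A \<union> B \<subseteq> ?L" "A \<inter> B = {}"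
      "card B \<le> card A" "P (A \<union> B)" "\<not> P A"
      "\<forall>X\<in>{A, B, A \<union> B}. \<forall>e. e \<noteq> {} \<longrightarrow> e \<subseteq> X \<longrightarrow> lca_size l e \<le> card X" by (elim exE conjE)
    have "\<forall>X\<in>{A, B, A \<union> B}. \<forall>e. e \<noteq> {} \<longrightarrow> e \<subseteq> X \<longrightarrow> lca_size (Node l r) e \<le> card X"
    proof (intro ballI allI impI)
      fix X e assume X: "X \<in> {A, B, A \<union> B}" "e \<noteq> {}" "e \<subseteq> X"
      then have "e \<subseteq> ?L" using AB(1) by blast
      with lca_l AB(6) X show "lca_size (Node l r) e \<le> card X" by metis
    qed
    moreover have "A \<union> B \<subseteq> set (leaves (Node l r))" using AB(1) by auto
    ultimately show ?thesis using AB by blast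
  next
    case 2
    then show ?thesis using bound_l bound_r bound disj Node.prems
      by (intro exI[of _ ?L] exI[of _ ?R]) auto
  next
    case 3
    from Node.IH(2)[OF dist(2) 3(2)] obtain A B where AB: "A \<union> B \<subseteq> ?R" "A \<inter> B = {}"
      "card B \<le> card A" "P (A \<union> B)" "\<not> P A"
      "\<forall>X\<in>{A, B, A \<union> B}. \<forall>e. e \<noteq> {} \<longrightarrow> e \<subseteq> X \<longrightarrow> lca_size r e \<le> card X" by (elim exE conjE)
    have "\<forall>X\<in>{A, B, A \<union> B}. \<forall>e. e \<noteq> {} \<longrightarrow> e \<subseteq> X \<longrightarrow> lca_size (Node l r) e \<le> card X"
    proof (intro ballI allI impI)
      fix X e assume X: "X \<in> {A, B, A \<union> B}" "e \<noteq> {}" "e \<subseteq> X"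
      then have "e \<subseteq> ?R" using AB(1) by blast
      with lca_r AB(6) X show "lca_size (Node l r) e \<le> card X" by metis
    qed
    moreover have "A \<union> B \<subseteq> set (leaves (Node l r))" using AB(1) by auto
    ultimately show ?thesis using AB by blast
  next
    case 4
    then show ?thesis using bound_l bound_r bound disj Node.prems
      by (intro exI[of _ ?R] exI[of _ ?L]) (auto simp: Un_commute)
  qed
qed

text \<open>The left side minus the right side factors as
  \<open>(x - \<Lambda>) * (B - \<Lambda> - x)\<close>.\<close>

lemma quadratic_gap:
  fixes x B \<Lambda> :: real
  assumes "x * (B - x) \<le> \<Lambda> * (B - \<Lambda>)"
  shows "x \<le> \<Lambda> \<or> B - \<Lambda> \<le> x"
proof (rule ccontr)
  assume "\<not> ?thesis"
  then have "0 < (x - \<Lambda>) * (B - \<Lambda> - x)" by simp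
  with assms show False by (simp add: algebra_simps)
qed

text \<open>The loss, as a function of \<open>u = y + r\<close>, is strictly concave and nonnegative at
  \<open>u = \<Lambda> - p / 2\<close> and at \<open>u = 2 * \<Lambda>\<close>, so it is positive in between.\<close>

lemma loss_tradeoff:
  fixes B \<Lambda> M p e y r :: real
  assumes sum: "B = p + e + y + r" and nn: "0 \<le> p" "0 \<le> e" "0 \<le> y" "0 \<le> r"
    and \<Lambda>: "0 < \<Lambda>" "3 * \<Lambda> \<le> B" "p \<le> \<Lambda>" "r \<le> \<Lambda>" "y < \<Lambda>" and "B \<le> M"
    and loss: "M * y + p * e + (B - r) * r \<le> \<Lambda> * (B - \<Lambda>)"
  shows "y + r + p / 2 \<le> \<Lambda>"
proof (rule ccontr)
  assume neg: "\<not> ?thesis"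
  define u where "u = y + r"
  define h where "h u = (B - u) * (u + p) - p\<^sup>2 - \<Lambda> * (B - \<Lambda>)" for u
  define u1 where "u1 = \<Lambda> - p / 2"
  have u: "u1 < u" "u < 2 * \<Lambda>" using neg \<Lambda> by (auto simp: u_def u1_def)
  \<comment> \<open>As \<open>B - u \<le> M\<close> and \<open>r \<le> u\<close>, both coefficients
    can be lowered to \<open>B - u\<close>; what remains depends only on \<open>u\<close> and
    \<open>p\<close>.\<close>
  have "(B - u) * y \<le> M * y" using nn assms(11) sum by (intro mult_right_mono) (auto simp: u_def)
  moreover have "(B - u) * r \<le> (B - r) * r" using nn by (intro mult_right_mono) (auto simp: u_def)
  moreover have "p * e = p * (B - u - p)" using sum by (simp add: u_def)
  ultimately have "h u \<le> 0" using loss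
    by (simp add: h_def u_def algebra_simps power2_eq_square)
  moreover have "0 \<le> h u1"
  proof -
    have "h u1 = p / 2 * (B - 3 / 2 * p)"
      by (simp add: h_def u1_def field_simps power2_eq_square)
    moreover have "0 \<le> p / 2 * (B - 3 / 2 * p)" using nn \<Lambda> by (intro mult_nonneg_nonneg) auto
    ultimately show ?thesis by simp
  qed
  moreover have "0 \<le> h (2 * \<Lambda>)"
  proof -
    have "h (2 * \<Lambda>) = \<Lambda> * (B - 3 * \<Lambda>) + p * (B - 2 * \<Lambda> - p)"
      by (simp add: h_def field_simps power2_eq_square)
    then show ?thesis using nn \<Lambda> by simp
  qed
  moreover have "(2 * \<Lambda> - u1) * h u = (2 * \<Lambda> - u) * h u1 + (u - u1) * h (2 * \<Lambda>)
      + (2 * \<Lambda> - u1) * ((u - u1) * (2 * \<Lambda> - u))"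
    unfolding h_def by algebra
  moreover have "0 < (2 * \<Lambda> - u1) * ((u - u1) * (2 * \<Lambda> - u))" using u by simp
  ultimately show False using u
    by (smt (verit, ccfv_SIG) mult_nonneg_nonneg mult_nonneg_nonpos)
qed

lemma weighted_graph_finite:
  assumes "weighted_graph V E w"
  shows "finite V" "finite E"
  using assms by (auto simp: weighted_graph_def intro: finite_subset[of E "Pow V"])

lemma total_weight_Un:
  "finite F \<Longrightarrow> finite F' \<Longrightarrow> F \<inter> F' = {} \<Longrightarrow>
    total_weight (F \<union> F') w = total_weight F w + total_weight F' w"
  unfolding total_weight_def by (rule sum.union_disjoint)

text \<open>\<open>max_cut\<close> ranges over subsets of \<open>U\<close>, while the greedy cut may
  also contain peeled vertices; intersecting with \<open>U\<close> cuts the same edges.\<close>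

lemma cut_weight_le_max_cut:
  assumes "finite U" "\<And>e. e \<in> F \<Longrightarrow> e \<subseteq> U"
  shows "cut_weight F w S \<le> max_cut U F w"
proof -
  have "cut_edges F (S \<inter> U) = cut_edges F S"
    using assms(2) by (fastforce simp: cut_edges_def)
  then have "cut_weight F w S = cut_weight F w (S \<inter> U)" by (simp add: cut_weight_def)
  also have "\<dots> \<le> max_cut U F w"
    unfolding max_cut_def using assms(1) by (intro Max_ge) auto
  finally show ?thesis .
qed

text \<open>The peel-off phase enters only through the degree bound \<open>deg\<close>. The last two
  hypotheses are the forms in which conditions (i) and (ii) are used.\<close>

lemma max_cut_ge:
  fixes V :: "'a set" and E EB :: "'a set set" and w :: "'a set \<Rightarrow> real" and \<gamma> \<epsilon> \<Lambda> :: real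
  defines "n \<equiv> real (card V)" and "W \<equiv> total_weight E w" and "B \<equiv> total_weight EB w"
  assumes graph: "weighted_graph V E w" and EB: "EB \<subseteq> E" "\<And>e. e \<in> EB \<Longrightarrow> e \<subseteq> VB" "VB \<subseteq> V"
    and deg: "\<And>v. v \<in> V \<Longrightarrow> incident_weight EB w v \<le> \<gamma> * (2 * W / n)" and \<gamma>: "1 \<le> \<gamma>"
    and OPT: "OPT V E w = (1 - \<epsilon>) * n * W"
    and \<Lambda>: "0 < \<Lambda>" "3 * \<Lambda> \<le> B" "2 * \<epsilon> * W < \<Lambda>" "2 * \<gamma> * \<epsilon> * W\<^sup>2 \<le> \<Lambda> * (B - \<Lambda>)"
  shows "B - \<Lambda> \<le> max_cut VB EB w"
proof -
  note fin = weighted_graph_finite[OF graph]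
  have finB: "finite EB" "finite VB"
    using fin(2) EB(1) fin(1) EB(3) by (auto intro: finite_subset)
  have w: "0 \<le> w e" "card e = 2" "e \<subseteq> V" if "e \<in> E" for e
    using graph that by (auto simp: weighted_graph_def)
  have wB: "0 \<le> w e" "card e = 2" "e \<subseteq> V" "e \<noteq> {}" if "e \<in> EB" for e
    using w[of e] EB that by auto
  have "EB \<noteq> {}" using \<Lambda> by (auto simp: B_def total_weight_def)
  then have "V \<noteq> {}" using wB by blast
  then have n: "0 < n" using fin by (simp add: n_def card_gt_0_iff)
  have "B \<le> W" unfolding B_def W_def total_weight_def
    using fin EB w by (intro sum_mono2) auto
  then have W: "0 < W" using \<Lambda> by simp
  then have BM: "B \<le> \<gamma> * W" using \<open>B \<le> W\<close> mult_right_mono[OF \<gamma>, of W] by linarith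
  obtain T where T: "hc_tree V T" and rev: "OPT V E w = revenue E w T"
    using OPT_attained[OF graph \<open>V \<noteq> {}\<close>] .
  have leaves: "distinct (leaves T)" "set (leaves T) = V" using T by (auto simp: hc_tree_def)
  have lcan: "real (lca_size T e) \<le> n" for e
    using lca_size_le[of T e] leaves distinct_card[of "leaves T"] by (simp add: n_def)
  have "revenue E w T = (1 - \<epsilon>) * n * W" using OPT rev by simp
  \<comment> \<open>The assumption on \<open>OPT\<close> becomes a budget: compared with the ideal
    \<open>n * W\<close>, the edges lose \<open>\<epsilon> * n * W\<close> in total.\<close>
  then have total_loss: "(\<Sum>e\<in>E. w e * (n - lca_size T e)) = \<epsilon> * n * W"
    by (simp add: revenue_def W_def total_weight_def right_diff_distrib sum_subtractf
        flip: sum_distrib_right) (simp add: algebra_simps)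
  have loss_le: "(\<Sum>e\<in>F. w e * (n - lca_size T e)) \<le> \<epsilon> * n * W" if "F \<subseteq> EB" for F
    unfolding total_loss[symmetric] using fin that EB w lcan by (intro sum_mono2) auto
  have loss_ge: "total_weight F w * (n - card X) \<le> (\<Sum>e\<in>F. w e * (n - lca_size T e))"
    if "F \<subseteq> EB" "\<And>e. e \<in> F \<Longrightarrow> lca_size T e \<le> card X" for F and X :: "'a set"
    unfolding total_weight_def sum_distrib_right
    using that wB by (intro sum_mono mult_left_mono) auto
  define out where "out X = total_weight {e\<in>EB. \<not> e \<subseteq> X} w" for X
  have out_split: "B = out X + total_weight {e\<in>EB. e \<subseteq> X} w" for X
  proof -
    have "EB = {e\<in>EB. \<not> e \<subseteq> X} \<union> {e\<in>EB. e \<subseteq> X}" by blast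
    then have "B = total_weight ({e\<in>EB. \<not> e \<subseteq> X} \<union> {e\<in>EB. e \<subseteq> X}) w" by (simp add: B_def)
    also have "\<dots> = out X + total_weight {e\<in>EB. e \<subseteq> X} w"
      unfolding out_def using finB by (intro total_weight_Un) auto
    finally show ?thesis .
  qed
  have tw_nonneg: "0 \<le> total_weight F w" if "F \<subseteq> EB" for F
    unfolding total_weight_def using that wB by (intro sum_nonneg) auto
  have out_nonneg: "0 \<le> out X" for X unfolding out_def by (rule tw_nonneg) auto
  \<comment> \<open>Each edge counted by \<open>out X\<close> has an endpoint in
    \<open>V - X\<close>, and each such vertex carries at most
    \<open>2 * \<gamma> * W / n\<close>.\<close>
  have out_deg: "n * out X \<le> 2 * \<gamma> * W * (n - card X)" if X: "X \<subseteq> V" for X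
  proof -
    have "out X \<le> (\<Sum>v\<in>V - X. incident_weight {e\<in>EB. \<not> e \<subseteq> X} w v)"
      unfolding out_def total_weight_def
    proof (rule sum_le_sum_incident_weight)
      show "e \<inter> (V - X) \<noteq> {}" if "e \<in> {e\<in>EB. \<not> e \<subseteq> X}" for e
        using that wB(3)[of e] by blast
    qed (use finB fin wB in auto)
    also have "\<dots> \<le> (\<Sum>v\<in>V - X. \<gamma> * (2 * W / n))"
    proof (rule sum_mono)
      fix v assume "v \<in> V - X"
      have "incident_weight {e\<in>EB. \<not> e \<subseteq> X} w v \<le> incident_weight EB w v"
        using finB wB by (intro incident_weight_mono) auto
      also have "\<dots> \<le> \<gamma> * (2 * W / n)" using deg \<open>v \<in> V - X\<close> by simp
      finally show "incident_weight {e\<in>EB. \<not> e \<subseteq> X} w v \<le> \<gamma> * (2 * W / n)" .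
    qed
    also have "\<dots> = (n - card X) * (\<gamma> * (2 * W / n))"
      using X fin by (simp add: n_def card_Diff_subset finite_subset card_mono of_nat_diff)
    finally show ?thesis using n by (simp add: field_simps)
  qed
  \<comment> \<open>The descent is run with \<open>out X \<le> \<Lambda>\<close> as
    \<open>P\<close>: a singleton contains no edge, so there \<open>out\<close> equals
    \<open>B\<close>, while at the root it is 0.\<close>
  have "\<not> out {x} \<le> \<Lambda>" for x
  proof -
    have "\<not> e \<subseteq> {x}" if "e \<in> EB" for e using wB(2)[OF that] card_mono[of "{x}" e] by auto
    then have "{e\<in>EB. \<not> e \<subseteq> {x}} = EB" by blast
    then show ?thesis using \<Lambda> by (simp add: out_def B_def)
  qed
  moreover have "out V \<le> \<Lambda>"
  proof -
    have "{e\<in>EB. \<not> e \<subseteq> V} = {}" using wB by blast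
    then have "out V = 0" by (simp only: out_def) (simp add: total_weight_def)
    then show ?thesis using \<Lambda> by simp
  qed
  ultimately obtain A D where AD: "A \<union> D \<subseteq> V" "A \<inter> D = {}" "card D \<le> card A"
    "out (A \<union> D) \<le> \<Lambda>" "\<not> out A \<le> \<Lambda>"
    and lca: "\<forall>X\<in>{A, D, A \<union> D}. \<forall>e. e \<noteq> {} \<longrightarrow> e \<subseteq> X \<longrightarrow> lca_size T e \<le> card X"
    using tree_descent[of T "\<lambda>X. out X \<le> \<Lambda>"] leaves by auto
  have finAD: "finite A" "finite D" using AD(1) fin(1) by (auto intro: finite_subset)
  \<comment> \<open>The weight \<open>B\<close> splits into \<open>r\<close> inside the larger child
    \<open>A\<close>, \<open>y\<close> inside \<open>D\<close>, \<open>e\<close> between them, and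
    \<open>p\<close> outside the node.\<close>
  define FA where "FA = {e\<in>EB. e \<subseteq> A}"
  define FD where "FD = {e\<in>EB. e \<subseteq> D}"
  define FC where "FC = {e\<in>EB. e \<subseteq> A \<union> D \<and> \<not> e \<subseteq> A \<and> \<not> e \<subseteq> D}"
  define p where "p = out (A \<union> D)"
  define e where "e = total_weight FC w"
  define y where "y = total_weight FD w"
  define r where "r = total_weight FA w"
  have sub: "FA \<subseteq> EB" "FD \<subseteq> EB" "FC \<subseteq> EB" by (auto simp: FA_def FD_def FC_def)
  have finF: "finite FA" "finite FD" "finite FC" using sub finB(1) by (auto intro: finite_subset)
  have disj: "FA \<inter> FD = {}" "(FA \<union> FD) \<inter> FC = {}"
    using AD(2) wB by (fastforce simp: FA_def FD_def FC_def)+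
  have "{e\<in>EB. e \<subseteq> A \<union> D} = FA \<union> FD \<union> FC" by (auto simp: FA_def FD_def FC_def)
  then have sum: "B = p + e + y + r"
    using out_split[of "A \<union> D"] finF disj
    by (simp add: total_weight_Un p_def e_def y_def r_def)
  have nn: "0 \<le> p" "0 \<le> e" "0 \<le> y" "0 \<le> r"
    using sub tw_nonneg out_nonneg by (auto simp: p_def e_def y_def r_def)
  have outA: "out A = B - r" using out_split[of A] by (simp add: r_def FA_def)
  have loss: "r * (n - card A) + y * (n - card D) + e * (n - card (A \<union> D)) \<le> \<epsilon> * n * W"
  proof -
    have "r * (n - card A) \<le> (\<Sum>e\<in>FA. w e * (n - lca_size T e))"
      unfolding r_def using sub lca wB by (intro loss_ge) (auto simp: FA_def)
    moreover have "y * (n - card D) \<le> (\<Sum>e\<in>FD. w e * (n - lca_size T e))"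
      unfolding y_def using sub lca wB by (intro loss_ge) (auto simp: FD_def)
    moreover have "e * (n - card (A \<union> D)) \<le> (\<Sum>e\<in>FC. w e * (n - lca_size T e))"
      unfolding e_def using sub lca wB by (intro loss_ge) (auto simp: FC_def)
    moreover have "(\<Sum>e\<in>FA. w e * (n - lca_size T e)) + (\<Sum>e\<in>FD. w e * (n - lca_size T e))
        + (\<Sum>e\<in>FC. w e * (n - lca_size T e)) = (\<Sum>e\<in>FA \<union> FD \<union> FC. w e * (n - lca_size T e))"
      using finF disj by (simp add: sum.union_disjoint)
    moreover have "\<dots> \<le> \<epsilon> * n * W" using sub by (intro loss_le) auto
    ultimately show ?thesis by linarith
  qed
  have cards: "real (card A) \<le> n" "real (card (A \<union> D)) \<le> n" "2 * real (card D) \<le> n"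
  proof -
    show 1: "real (card (A \<union> D)) \<le> n" unfolding n_def using AD fin by (simp add: card_mono)
    then show "real (card A) \<le> n" "2 * real (card D) \<le> n"
      using AD finAD by (auto simp: card_Un_disjoint)
  qed
  \<comment> \<open>All losses are multiplied by \<open>2 * \<gamma> * W\<close>, so that
    \<open>out_deg\<close> can turn missing cluster size into outside weight.\<close>
  have budget: "2 * \<gamma> * W * (\<epsilon> * n * W) \<le> n * (\<Lambda> * (B - \<Lambda>))"
    using mult_left_mono[OF \<Lambda>(4), of n] n by (simp add: power2_eq_square mult_ac)
  have \<gamma>W: "0 \<le> 2 * \<gamma> * W" using \<gamma> W by simp
  have prA: "n * (B - r) * r \<le> 2 * \<gamma> * W * (r * (n - card A))"
    using mult_right_mono[OF out_deg[of A] nn(4)] AD(1) by (simp add: outA mult_ac)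
  have prC: "n * p * e \<le> 2 * \<gamma> * W * (e * (n - card (A \<union> D)))"
    using mult_right_mono[OF out_deg[of "A \<union> D"] nn(2)] AD(1) by (simp add: p_def mult_ac)
  \<comment> \<open>The smaller child \<open>D\<close> has at most \<open>n / 2\<close> vertices, so
    its edges lose at least half of their ideal revenue.\<close>
  have prD: "n * (\<gamma> * W * y) \<le> 2 * \<gamma> * W * (y * (n - card D))"
  proof -
    have "n * (\<gamma> * W * y) \<le> (2 * (n - card D)) * (\<gamma> * W * y)"
      using cards nn W \<gamma> by (intro mult_right_mono) auto
    then show ?thesis by (simp add: mult_ac)
  qed
  have nnA: "0 \<le> r * (n - card A)" "0 \<le> y * (n - card D)" "0 \<le> e * (n - card (A \<union> D))"
    using cards nn n by auto
  have "n * ((B - r) * (B - (B - r))) \<le> n * (\<Lambda> * (B - \<Lambda>))"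
    using prA mult_left_mono[OF order_trans[OF _ loss] \<gamma>W, of "r * (n - card A)"] nnA budget
    by (simp add: mult.assoc)
  then have "(B - r) * (B - (B - r)) \<le> \<Lambda> * (B - \<Lambda>)" using n by simp
  \<comment> \<open>Here \<open>x = out A = B - r\<close> exceeds \<open>\<Lambda>\<close>, so it
    must already lie beyond the gap.\<close>
  then have "r \<le> \<Lambda>" using quadratic_gap[of "B - r" B \<Lambda>] AD(5) outA by auto
  moreover have "y < \<Lambda>"
  proof -
    have "y * n \<le> y * (2 * (n - card D))" using cards nn by (intro mult_left_mono) auto
    also have "\<dots> = 2 * (y * (n - card D))" by simp
    also have "\<dots> \<le> 2 * (\<epsilon> * n * W)" using loss nnA by linarith
    also have "\<dots> = n * (2 * \<epsilon> * W)" by simp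
    also have "\<dots> < n * \<Lambda>" using n \<Lambda> by (intro mult_strict_left_mono) auto
    finally show ?thesis using n by (simp add: mult.commute)
  qed
  moreover have "\<gamma> * W * y + p * e + (B - r) * r \<le> \<Lambda> * (B - \<Lambda>)"
  proof -
    have "n * (\<gamma> * W * y + p * e + (B - r) * r)
        \<le> 2 * \<gamma> * W * (r * (n - card A) + y * (n - card D) + e * (n - card (A \<union> D)))"
      using prA prC prD by (simp add: distrib_left mult.assoc)
    also have "\<dots> \<le> 2 * \<gamma> * W * (\<epsilon> * n * W)" using loss \<gamma>W by (rule mult_left_mono)
    also note budget
    finally show ?thesis using n by simp
  qed
  \<comment> \<open>The left side is what a cut worth \<open>e + p / 2\<close> misses: the edges
    inside \<open>A\<close> and \<open>D\<close>, and half of those outside the node.\<close>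
  ultimately have trade: "y + r + p / 2 \<le> \<Lambda>"
    using sum nn \<Lambda> AD(4) BM by (intro loss_tradeoff[of B p e y r \<Lambda> "\<gamma> * W"]) (auto simp: p_def)
  define H where "H = V - (A \<union> D)"
  have "\<exists>S. A \<subseteq> S \<and> S \<subseteq> A \<union> H \<and>
    (\<Sum>e\<in>{e\<in>EB. e \<inter> A \<noteq> {} \<and> e \<inter> D \<noteq> {}}. w e) + (\<Sum>e\<in>{e\<in>EB. e \<inter> H \<noteq> {}}. w e) / 2
      \<le> cut_weight EB w S"
    by (rule exists_cut_extending) (use fin finB wB AD in \<open>auto simp: H_def\<close>)
  then obtain S where S: "(\<Sum>e\<in>{e\<in>EB. e \<inter> A \<noteq> {} \<and> e \<inter> D \<noteq> {}}. w e)
      + (\<Sum>e\<in>{e\<in>EB. e \<inter> H \<noteq> {}}. w e) / 2 \<le> cut_weight EB w S" by blast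
  have "e \<le> (\<Sum>e\<in>{e\<in>EB. e \<inter> A \<noteq> {} \<and> e \<inter> D \<noteq> {}}. w e)"
    unfolding e_def total_weight_def using finB wB by (intro sum_mono2) (auto simp: FC_def)
  moreover have "p = (\<Sum>e\<in>{e\<in>EB. e \<inter> H \<noteq> {}}. w e)"
    unfolding p_def out_def total_weight_def using wB(3) by (intro sum.cong) (auto simp: H_def)
  ultimately have "B - \<Lambda> \<le> cut_weight EB w S" using S trade sum by linarith
  also have "\<dots> \<le> max_cut VB EB w" using finB EB by (intro cut_weight_le_max_cut)
  finally show ?thesis .
qed

section \<open>Algorithm PMR\<close>

lemma peeling_partition:
  assumes "peeling V E w \<gamma> vs VB EB" and graph: "weighted_graph V E w"
  shows "set vs \<union> VB = V" "set vs \<inter> VB = {}" "distinct vs" "EB = {e\<in>E. e \<subseteq> VB}"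
proof -
  from assms(1) have "set vs \<union> VB = V \<and> set vs \<inter> VB = {} \<and> distinct vs \<and> EB = {e\<in>E. e \<subseteq> VB}"
    by induction (use graph in \<open>auto simp: weighted_graph_def\<close>)
  then show "set vs \<union> VB = V" "set vs \<inter> VB = {}" "distinct vs" "EB = {e\<in>E. e \<subseteq> VB}" by auto
qed

text \<open>The weights at removal decrease, while the sizes of the clusters that earn them decrease
  as well; Chebyshev's sum inequality bounds the revenue by the average cluster size. The
  invariant behind it is that every remaining vertex carries at most the average removed weight.\<close>

lemma peeling_red_weight:
  assumes "peeling V E w \<gamma> vs VB EB" and graph: "weighted_graph V E w"
  shows "peel_threshold V E w \<gamma> * length vs \<le> total_weight (E - EB) w"
    and "hc_tree VB T \<Longrightarrow> total_weight (E - EB) w * (real (card V) - length vs / 2)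
           \<le> revenue (E - EB) w (attach_peeled vs T)"
proof -
  note fin = weighted_graph_finite[OF graph]
  \<comment> \<open>The middle conjunct is the averaging invariant. \<open>T\<close> is quantified
    because the induction step uses the hypothesis for \<open>Node (Leaf v) T\<close>.\<close>
  have "peel_threshold V E w \<gamma> * length vs \<le> total_weight (E - EB) w \<and>
    (\<forall>u\<in>VB. length vs * incident_weight EB w u \<le> total_weight (E - EB) w) \<and>
    (\<forall>T. hc_tree VB T \<longrightarrow> total_weight (E - EB) w * (real (card V) - length vs / 2)
           \<le> revenue (E - EB) w (attach_peeled vs T))"
    using assms(1)
  proof induction
    case peel_start
    show ?case by (simp add: total_weight_def revenue_def)
  next
    case (peel_step vs VB EB v)
    note part = peeling_partition[OF peel_step.hyps(1) graph]
    define r where "r = real (length vs)"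
    define X where "X = total_weight (E - EB) w"
    define x where "x = incident_weight EB w v"
    define Fv where "Fv = {e\<in>EB. v \<in> e}"
    let ?E' = "{e\<in>EB. v \<notin> e}"
    have E': "E - ?E' = (E - EB) \<union> Fv" "(E - EB) \<inter> Fv = {}" "finite (E - EB)" "finite Fv"
      using part(4) fin by (auto simp: Fv_def)
    have x: "total_weight Fv w = x" by (simp add: x_def Fv_def total_weight_def incident_weight_def)
    then have X': "total_weight (E - ?E') w = X + x"
      unfolding E'(1) X_def using E' by (simp add: total_weight_Un)
    have wEB: "0 \<le> w e" if "e \<in> EB" for e
      using that part(4) graph by (auto simp: weighted_graph_def)
    have x0: "0 \<le> x" unfolding x_def incident_weight_def using wEB by (intro sum_nonneg) auto
    have rx: "r * x \<le> X" using peel_step.IH peel_step.hyps(2) by (simp add: r_def x_def X_def)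
    have "length (vs @ [v]) * incident_weight ?E' w u \<le> X + x" if "u \<in> VB - {v}" for u
    proof -
      have "incident_weight ?E' w u \<le> incident_weight EB w u"
        using part(4) fin wEB by (intro incident_weight_mono) auto
      also have "\<dots> \<le> x" using that peel_step.hyps(4) by (simp add: x_def)
      finally have "(r + 1) * incident_weight ?E' w u \<le> (r + 1) * x"
        by (intro mult_left_mono) (auto simp: r_def)
      with rx show ?thesis by (simp add: r_def algebra_simps)
    qed
    moreover have "peel_threshold V E w \<gamma> * length (vs @ [v]) \<le> X + x"
      using peel_step by (simp add: X_def x_def algebra_simps)
    moreover have "(X + x) * (real (card V) - length (vs @ [v]) / 2)
        \<le> revenue (E - ?E') w (attach_peeled (vs @ [v]) T)" if T: "hc_tree (VB - {v}) T" for T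
    proof -
      let ?T = "Node (Leaf v) T"
      have hT: "hc_tree VB ?T" using T peel_step.hyps(2) by (auto simp: hc_tree_def)
      have "card V = length vs + card VB"
        using part(1-3) fin by (metis card_Un_disjoint distinct_card finite_Un)
      then have cVB: "real (card VB) = real (card V) - r" by (simp add: r_def)
      have lenT: "length (leaves ?T) = card VB" using hT by (metis hc_tree_def distinct_card)
      \<comment> \<open>An edge of \<open>EB\<close> at \<open>v\<close> is separated exactly when
        \<open>v\<close> leaves the cluster \<open>VB\<close>.\<close>
      have "lca_size (attach_peeled vs ?T) e = card VB" if "e \<in> Fv" for e
      proof -
        have e: "e \<in> E" "e \<subseteq> VB" "v \<in> e" using that part(4) by (auto simp: Fv_def)
        then have "card e = 2" using graph by (simp add: weighted_graph_def)
        then have "\<not> e \<subseteq> {v}" using card_mono[of "{v}" e] by auto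
        moreover have "\<not> e \<subseteq> set (leaves T)" using e T by (auto simp: hc_tree_def)
        ultimately have "lca_size ?T e = card VB" using lenT by (simp add: lca_size_Node_split)
        moreover have "e \<subseteq> set (leaves ?T)" using e hT by (simp add: hc_tree_def)
        ultimately show ?thesis using lca_size_attach_peeled[of e ?T vs] \<open>card e = 2\<close> by simp
      qed
      then have revFv: "revenue Fv w (attach_peeled vs ?T) = x * (real (card V) - r)"
        using x cVB by (simp add: revenue_def total_weight_def flip: sum_distrib_right)
      have "attach_peeled (vs @ [v]) T = attach_peeled vs ?T" by (simp add: attach_peeled_def)
      then have "revenue (E - ?E') w (attach_peeled (vs @ [v]) T)
          = revenue (E - EB) w (attach_peeled vs ?T) + x * (real (card V) - r)"
        unfolding E'(1) using E' revFv by (simp add: revenue_Un)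
      moreover have "X * (real (card V) - r / 2) \<le> revenue (E - EB) w (attach_peeled vs ?T)"
        using peel_step.IH hT by (simp add: X_def r_def)
      \<comment> \<open>The averaging invariant \<open>r * x \<le> X\<close> makes the correction
        term nonnegative.\<close>
      moreover have "(X + x) * (real (card V) - length (vs @ [v]) / 2)
          \<le> X * (real (card V) - r / 2) + x * (real (card V) - r)"
      proof -
        have "(X + x) * (real (card V) - length (vs @ [v]) / 2)
            = X * (real (card V) - r / 2) + x * (real (card V) - r) - (X - r * x + x) / 2"
          by (simp add: r_def field_simps)
        moreover have "0 \<le> (X - r * x + x) / 2" using rx x0 by simp
        ultimately show ?thesis by simp
      qed
      ultimately show ?thesis by simp
    qed
    ultimately show ?case unfolding X' by blast
  qed
  then show "peel_threshold V E w \<gamma> * length vs \<le> total_weight (E - EB) w"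
    and "hc_tree VB T \<Longrightarrow> total_weight (E - EB) w * (real (card V) - length vs / 2)
           \<le> revenue (E - EB) w (attach_peeled vs T)" by auto
qed

section \<open>Output distribution and expected revenue of the cut\<close>

lemma PMR_output_support:
  assumes "red_fraction E EB w \<le> Rstar" "set_pmf (gw VB EB w) \<subseteq> Pow VB" "finite VB" "VB \<noteq> {}"
    and "(c, T) \<in> set_pmf (PMR_output gw E w Rstar vs VB EB)"
  obtains S T' where "c = Some S" "S \<subseteq> VB" "T = attach_peeled vs T'" "hc_tree VB T'"
    "T' \<in> set_pmf (split_and_partition VB S)"
proof -
  obtain S T' where S: "S \<in> set_pmf (gw VB EB w)" and T': "T' \<in> set_pmf (split_and_partition VB S)"
    and cT: "c = Some S" "T = attach_peeled vs T'"
    using assms(1,5) by (auto simp: PMR_output_def)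
  have "S \<subseteq> VB" using S assms(2) by blast
  moreover have "hc_tree VB T'"
    using split_and_partition_hc_tree[OF T' assms(3,4) \<open>S \<subseteq> VB\<close>] .
  ultimately show thesis using that[of S T'] cT T' by blast
qed

text \<open>Crossing edges are separated at the root of the tree on \<open>VB\<close>, whatever
  Random Partitioning does below. The integrand therefore depends on the cut alone, and the tree can
  be projected away.\<close>

lemma ALG_C_PMR_output:
  assumes red: "red_fraction E EB w \<le> Rstar" and gw: "set_pmf (gw VB EB w) \<subseteq> Pow VB"
    and graph: "weighted_graph VB EB w" and "VB \<noteq> {}"
  shows "ALG_C EB w (PMR_output gw E w Rstar vs VB EB)
    = card VB * measure_pmf.expectation (gw VB EB w) (cut_weight EB w)"
proof -
  define out where "out = PMR_output gw E w Rstar vs VB EB"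
  define g where "g c = (case c of None \<Rightarrow> 0 | Some S \<Rightarrow> card VB * cut_weight EB w S)"
    for c :: "'a set option"
  have fin: "finite VB" using weighted_graph_finite[OF graph] by simp
  have "(case c of None \<Rightarrow> 0 | Some S \<Rightarrow> revenue (cut_edges EB S) w T) = g c"
    if "(c, T) \<in> set_pmf out" for c T
  proof -
    from that[unfolded out_def] obtain S T' where c: "c = Some S" and S: "S \<subseteq> VB"
      and T: "T = attach_peeled vs T'" and T': "hc_tree VB T'"
      and supp: "T' \<in> set_pmf (split_and_partition VB S)"
      using PMR_output_support[where gw = gw, OF red gw fin \<open>VB \<noteq> {}\<close>] by blast
    have "lca_size T e = card VB" if "e \<in> cut_edges EB S" for e
    proof -
      have e: "e \<in> EB" "e \<inter> S \<noteq> {}" "e - S \<noteq> {}" using that by (auto simp: cut_edges_def)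
      then have eV: "e \<subseteq> VB" "card e = 2" using graph by (auto simp: weighted_graph_def)
      \<comment> \<open>A crossing edge rules out the degenerate branch of
        \<open>split_and_partition\<close>.\<close>
      then have "S \<noteq> {}" "S \<noteq> VB" using e by auto
      with supp obtain l r where lr: "T' = Node l r" "l \<in> set_pmf (random_partitioning S)"
        "r \<in> set_pmf (random_partitioning (VB - S))"
        by (auto simp: split_and_partition_def)
      have "hc_tree S l"
        using lr(2) finite_subset[OF S fin] \<open>S \<noteq> {}\<close> by (rule random_partitioning_hc_tree)
      moreover have "hc_tree (VB - S) r"
        using lr(3) fin \<open>S \<noteq> VB\<close> S by (intro random_partitioning_hc_tree) auto
      ultimately have "\<not> e \<subseteq> set (leaves l)" "\<not> e \<subseteq> set (leaves r)"
        using e by (auto simp: hc_tree_def)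
      then have "lca_size T' e = length (leaves T')"
        unfolding lr(1) by (simp add: lca_size_Node_split)
      also have "\<dots> = card VB" using T' by (metis hc_tree_def distinct_card)
      finally show ?thesis
        using lca_size_attach_peeled[of e T' vs] eV T T' by (simp add: hc_tree_def)
    qed
    then show ?thesis
      unfolding c g_def by (simp add: revenue_def cut_weight_def sum_distrib_left mult.commute)
  qed
  then have "ALG_C EB w out = measure_pmf.expectation out (\<lambda>x. g (fst x))"
    unfolding ALG_C_def by (intro integral_cong_AE) (auto simp: AE_measure_pmf_iff)
  also have "\<dots> = measure_pmf.expectation (map_pmf fst out) g" by simp
  also have "map_pmf fst out = map_pmf Some (gw VB EB w)"
    using red by (simp add: out_def PMR_output_def map_bind_pmf map_pmf_comp map_pmf_const)
      (simp add: map_pmf_def)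
  also have "measure_pmf.expectation \<dots> g
      = card VB * measure_pmf.expectation (gw VB EB w) (cut_weight EB w)"
    by (simp add: g_def)
  finally show ?thesis by (simp add: out_def)
qed

text \<open>The guarantee is convex in the red fraction \<open>x\<close>, and the last assumption says that its
  derivative at \<open>R\<close> is at most zero, so on \<open>x \<le> R\<close> it is smallest at \<open>R\<close>.\<close>

lemma F_PMR_le:
  fixes a \<gamma> x R :: real
  assumes a: "1 / 2 \<le> a" and \<gamma>: "0 < \<gamma>" and "x \<le> R"
    and cond: "R * (a / 2 - 1 / 6) + \<gamma> * (1 - a) \<le> 1 / 3"
  shows "F_PMR \<gamma> R
    \<le> (1 - x / (4 * \<gamma>)) * x + (1 - x / (2 * \<gamma>)) * (a * (1 - x) - (a - 2 / 3) * (1 - R))"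
    (is "_ \<le> ?G")
proof -
  \<comment> \<open>This is the exact second-order expansion at \<open>R\<close>; its linear
    coefficient is the slack in \<open>cond\<close>.\<close>
  have "\<gamma> * (?G - F_PMR \<gamma> R) = (R - x) * (1 / 3 - (R * (a / 2 - 1 / 6) + \<gamma> * (1 - a)))
      + (R - x)\<^sup>2 * (2 * a - 1) / 4"
    using \<gamma> by (simp add: F_PMR_def field_simps power2_eq_square)
  moreover have "0 \<le> (R - x) * (1 / 3 - (R * (a / 2 - 1 / 6) + \<gamma> * (1 - a)))"
    using assms by (intro mult_nonneg_nonneg) auto
  moreover have "0 \<le> (R - x)\<^sup>2 * (2 * a - 1) / 4" using a by simp
  ultimately have "0 \<le> \<gamma> * (?G - F_PMR \<gamma> R)" by simp
  then show ?thesis using \<gamma> by (simp add: zero_le_mult_iff)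
qed

lemma revenue_nonneg: "(\<And>e. e \<in> F \<Longrightarrow> 0 \<le> w e) \<Longrightarrow> 0 \<le> revenue F w T"
  unfolding revenue_def by (intro sum_nonneg) auto

lemma ALG_C_nonneg:
  assumes "\<And>e. e \<in> EB \<Longrightarrow> 0 \<le> w e"
  shows "0 \<le> ALG_C EB w out"
  unfolding ALG_C_def using assms
  by (intro Bochner_Integration.integral_nonneg) (auto split: option.split intro!: revenue_nonneg simp: cut_edges_def)

theorem theorem5:
  fixes V :: "'a set" and E :: "'a set set" and w :: "'a set \<Rightarrow> real"
    and gw :: "'a set \<Rightarrow> 'a set set \<Rightarrow> ('a set \<Rightarrow> real) \<Rightarrow> 'a set pmf"
    and \<gamma> Rstar \<epsilon> :: real
    and vs :: "'a list" and VB :: "'a set" and EB :: "'a set set"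
    and c :: "'a set option" and T :: "'a hct"
  assumes graph: "weighted_graph V E w"
    and gw: "gw_algorithm gw"
    and gamma: "\<gamma> \<ge> 1"
    and Rstar: "0 < Rstar" "Rstar < 1 / 2"
    and peel: "peel_off V E w \<gamma> vs VB EB"
    and red: "red_fraction E EB w \<le> Rstar"
    and eps: "OPT V E w = (1 - \<epsilon>) * real (card V) * total_weight E w"
    and cond_i: "Rstar < 1 - 6 * alpha_GW / (3 * alpha_GW - 2) * \<epsilon>"
    and cond_ii: "\<epsilon> \<noteq> 0 \<Longrightarrow>
      \<gamma> \<le> (1 - Rstar)\<^sup>2 * ((3 * alpha_GW - 2) / (9 * alpha_GW\<^sup>2)) * (1 / \<epsilon>)"
    and cond_iii: "1 / 3 \<ge> Rstar * (alpha_GW / 2 - 1 / 6) + \<gamma> * (1 - alpha_GW)"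
    and outcome: "(c, T) \<in> set_pmf (PMR_output gw E w Rstar vs VB EB)"
  shows "ALG_P E EB w T + ALG_C EB w (PMR_output gw E w Rstar vs VB EB)
           \<ge> real (card V) * total_weight E w * F_PMR \<gamma> Rstar"
proof -
  note fin = weighted_graph_finite[OF graph]
  from peel have peeling: "peeling V E w \<gamma> vs VB EB"
    and stop: "\<And>v. v \<in> VB \<Longrightarrow> incident_weight EB w v < peel_threshold V E w \<gamma>"
    by (auto simp: peel_off_def)
  note part = peeling_partition[OF peeling graph]
  have wE: "0 \<le> w e" if "e \<in> E" for e using graph that by (auto simp: weighted_graph_def)
  have EB: "EB \<subseteq> E" "\<And>e. e \<in> EB \<Longrightarrow> e \<subseteq> VB" "VB \<subseteq> V" using part by auto
  have finB: "finite VB" "finite EB" using fin EB(1,3) by (auto intro: finite_subset)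
  define n where "n = real (card V)"
  define W where "W = total_weight E w"
  define \<alpha> where "\<alpha> = alpha_GW"
  define R where "R = red_fraction E EB w"
  define k where "k = real (length vs)"
  have W0: "0 \<le> W" unfolding W_def total_weight_def using wE by (rule sum_nonneg)
  show ?thesis
  proof (cases "W = 0")
    \<comment> \<open>The claimed bound is 0 here, so nonnegative revenues suffice;
      \<open>red_fraction\<close> has the default value 0 of a division by zero.\<close>
    case True
    have "0 \<le> ALG_P E EB w T" unfolding ALG_P_def using wE by (intro revenue_nonneg) auto
    moreover have "0 \<le> ALG_C EB w (PMR_output gw E w Rstar vs VB EB)"
      using wE EB(1) by (intro ALG_C_nonneg) auto
    ultimately show ?thesis using True by (simp add: W_def)
  next
    case False
    with W0 have W: "0 < W" by simp
    have \<alpha>: "2 / 3 < \<alpha>" "\<alpha> \<le> 1" using alpha_GW_bounds by (simp_all add: \<alpha>_def)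
    have "V \<noteq> {}"
    proof
      assume "V = {}"
      then have "E = {}" using graph by (auto simp: weighted_graph_def)
      then show False using W by (simp add: W_def total_weight_def)
    qed
    then have n: "0 < n" using fin by (simp add: n_def card_gt_0_iff)
    have X: "total_weight (E - EB) w = R * W"
      using False by (simp add: R_def red_fraction_def W_def)
    have "E = (E - EB) \<union> EB" using EB(1) by blast
    then have "W = total_weight ((E - EB) \<union> EB) w" by (simp add: W_def)
    also have "\<dots> = R * W + total_weight EB w"
      unfolding X[symmetric] using fin finB by (intro total_weight_Un) auto
    finally have B: "total_weight EB w = (1 - R) * W" by (simp add: algebra_simps)
    have R: "R \<le> Rstar" using red by (simp add: R_def)
    have "0 < total_weight EB w" unfolding B using R Rstar W by simp
    then have "EB \<noteq> {}" by (auto simp: total_weight_def)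
    have graphB: "weighted_graph VB EB w"
      using graph EB finB by (auto simp: weighted_graph_def)
    then have "VB \<noteq> {}" using \<open>EB \<noteq> {}\<close> by (auto simp: weighted_graph_def)
    have gwB: "set_pmf (gw VB EB w) \<subseteq> Pow VB"
      "\<alpha> * max_cut VB EB w \<le> measure_pmf.expectation (gw VB EB w) (cut_weight EB w)"
      using gw graphB unfolding gw_algorithm_def \<alpha>_def by blast+

    \<comment> \<open>\<open>l\<close> is chosen so that \<open>\<alpha> * (1 - l) = 2 / 3\<close>:
      at \<open>R = Rstar\<close> the cut guarantee becomes \<open>2 / 3 * (1 - Rstar) * W\<close>,
      as in \<open>F_PMR\<close>.\<close>
    define l where "l = (3 * \<alpha> - 2) / (3 * \<alpha>)"
    define \<Lambda> where "\<Lambda> = l * (1 - Rstar) * W"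
    have l: "0 < l" "3 * l \<le> 1" using \<alpha> by (simp_all add: l_def field_simps)
    have \<Lambda>: "0 < \<Lambda>" "3 * \<Lambda> \<le> (1 - R) * W"
    proof -
      show "0 < \<Lambda>" using l Rstar W by (simp add: \<Lambda>_def)
      have "3 * l * ((1 - Rstar) * W) \<le> 1 * ((1 - Rstar) * W)"
        using l Rstar W by (intro mult_right_mono) auto
      also have "\<dots> \<le> (1 - R) * W" using R W by simp
      finally show "3 * \<Lambda> \<le> (1 - R) * W" by (simp add: \<Lambda>_def mult_ac)
    qed
    have "total_weight EB w - \<Lambda> \<le> max_cut VB EB w"
    proof (rule max_cut_ge[OF graph EB])
      show "incident_weight EB w v \<le> \<gamma> * (2 * total_weight E w / card V)" if "v \<in> V" for v
      proof (cases "v \<in> VB")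
        case True
        then show ?thesis using stop[of v] by (simp add: peel_threshold_def)
      next
        case False
        then have "{e\<in>EB. v \<in> e} = {}" using EB(2) by blast
        then have "incident_weight EB w v = 0" by (simp only: incident_weight_def sum.empty)
        then show ?thesis using gamma W n by (simp add: W_def n_def)
      qed
      show "1 \<le> \<gamma>" by (rule gamma)
      show "OPT V E w = (1 - \<epsilon>) * card V * total_weight E w" by (rule eps)
      show "0 < \<Lambda>" by (rule \<Lambda>)
      show "3 * \<Lambda> \<le> total_weight EB w" using \<Lambda> by (simp add: B)
      \<comment> \<open>Condition (i) rearranged, since
        \<open>6 * \<alpha> / (3 * \<alpha> - 2) = 2 / l\<close>.\<close>
      have "2 * \<epsilon> < l * (1 - Rstar)"
        using cond_i \<alpha> by (simp add: l_def \<alpha>_def field_simps)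
      then have "2 * \<epsilon> * W < l * (1 - Rstar) * W" using W by (rule mult_strict_right_mono)
      then show "2 * \<epsilon> * total_weight E w < \<Lambda>" by (simp add: \<Lambda>_def W_def)
      \<comment> \<open>For positive \<open>\<epsilon>\<close> this is condition (ii) multiplied by
        \<open>2 * \<epsilon>\<close>; otherwise the left side is at most 0.\<close>
      have "2 * \<gamma> * \<epsilon> \<le> 2 * ((1 - Rstar)\<^sup>2 * ((3 * \<alpha> - 2) / (9 * \<alpha>\<^sup>2)))"
      proof (cases "0 < \<epsilon>")
        case True
        with cond_ii have "\<gamma> \<le> (1 - Rstar)\<^sup>2 * ((3 * \<alpha> - 2) / (9 * \<alpha>\<^sup>2)) / \<epsilon>"
          by (simp add: \<alpha>_def)
        then have "\<gamma> * \<epsilon> \<le> (1 - Rstar)\<^sup>2 * ((3 * \<alpha> - 2) / (9 * \<alpha>\<^sup>2))"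
          using True by (simp only: pos_le_divide_eq)
        then show ?thesis by linarith
      next
        case False
        then have "2 * \<gamma> * \<epsilon> \<le> 0" using gamma by (simp add: mult_nonneg_nonpos)
        also have "0 \<le> 2 * ((1 - Rstar)\<^sup>2 * ((3 * \<alpha> - 2) / (9 * \<alpha>\<^sup>2)))" using \<alpha> by simp
        finally show ?thesis .
      qed
      \<comment> \<open>Because \<open>1 - l = 2 / (3 * \<alpha>)\<close>, the constant in condition
        (ii) is half of \<open>l * (1 - l)\<close>.\<close>
      also have "\<dots> = l * (1 - Rstar) * ((1 - Rstar) - l * (1 - Rstar))"
        using \<alpha> by (simp add: l_def field_simps power2_eq_square)
      finally have "2 * \<gamma> * \<epsilon> * W\<^sup>2 \<le> l * (1 - Rstar) * ((1 - Rstar) - l * (1 - Rstar)) * W\<^sup>2"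
        by (rule mult_right_mono) simp
      also have "\<dots> = \<Lambda> * ((1 - Rstar) * W - \<Lambda>)"
        by (simp add: \<Lambda>_def power2_eq_square algebra_simps)
      also have "\<dots> \<le> \<Lambda> * ((1 - R) * W - \<Lambda>)"
        using \<Lambda> R W by (intro mult_left_mono) auto
      finally show "2 * \<gamma> * \<epsilon> * (total_weight E w)\<^sup>2 \<le> \<Lambda> * (total_weight EB w - \<Lambda>)"
        by (simp add: B W_def)
    qed
    then have "\<alpha> * ((1 - R) * W - \<Lambda>) \<le> \<alpha> * max_cut VB EB w"
      unfolding B using \<alpha> by (intro mult_left_mono) auto
    with gwB(2) have cut: "\<alpha> * ((1 - R) * W - \<Lambda>)
        \<le> measure_pmf.expectation (gw VB EB w) (cut_weight EB w)" by linarith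
    have cut_nonneg: "0 \<le> \<alpha> * ((1 - R) * W - \<Lambda>)" using \<Lambda> \<alpha> by simp

    \<comment> \<open>Each peeled vertex removes at least the threshold weight, which bounds their
      number \<open>k\<close>. This bound serves both the average cluster size in \<open>P\<close>
      and the size of \<open>VB\<close> in \<open>C\<close>.\<close>
    have "\<gamma> * (2 * W / n) * k \<le> R * W"
      using peeling_red_weight(1)[OF peeling graph]
      by (simp add: X peel_threshold_def W_def n_def k_def)
    then have "W * (2 * \<gamma> * k) \<le> W * (n * R)" using n by (simp add: field_simps)
    then have k: "k \<le> n * R / (2 * \<gamma>)" using W gamma by (simp add: field_simps)
    have R0: "0 \<le> R"
      using X W wE sum_nonneg[of "E - EB" w] by (simp add: total_weight_def zero_le_mult_iff)
    obtain T' where T: "T = attach_peeled vs T'" "hc_tree VB T'"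
      using PMR_output_support[where gw = gw, OF red gwB(1) finB(1) \<open>VB \<noteq> {}\<close> outcome] by metis
    have "k / 2 \<le> n * R / (2 * \<gamma>) / 2" using k by (rule divide_right_mono) simp
    then have "k / 2 \<le> n * R / (4 * \<gamma>)" by simp
    then have "R * W * (n - n * R / (4 * \<gamma>)) \<le> R * W * (n - k / 2)"
      using R0 W by (intro mult_left_mono) auto
    also have "\<dots> \<le> ALG_P E EB w T"
      using peeling_red_weight(2)[OF peeling graph T(2)]
      by (simp add: ALG_P_def T(1) X n_def k_def)
    finally have P: "R * W * (n - n * R / (4 * \<gamma>)) \<le> ALG_P E EB w T" .

    have "card V = length vs + card VB"
      using part(1-3) finB(1) by (metis List.finite_set card_Un_disjoint distinct_card)
    then have "card VB = n - k" by (simp add: n_def k_def)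
    then have "(n - n * R / (2 * \<gamma>)) * (\<alpha> * ((1 - R) * W - \<Lambda>))
        \<le> card VB * (\<alpha> * ((1 - R) * W - \<Lambda>))"
      using k cut_nonneg by (intro mult_right_mono) auto
    also have "\<dots> \<le> card VB * measure_pmf.expectation (gw VB EB w) (cut_weight EB w)"
      using cut by (rule mult_left_mono) simp
    also have "\<dots> = ALG_C EB w (PMR_output gw E w Rstar vs VB EB)"
      using ALG_C_PMR_output[where gw = gw, OF red gwB(1) graphB \<open>VB \<noteq> {}\<close>] by simp
    finally have C: "(n - n * R / (2 * \<gamma>)) * (\<alpha> * ((1 - R) * W - \<Lambda>))
        \<le> ALG_C EB w (PMR_output gw E w Rstar vs VB EB)" .

    \<comment> \<open>This rewrites the cut guarantee in the form expected by
      \<open>F_PMR_le\<close>.\<close>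
    have "\<alpha> * \<Lambda> = (\<alpha> - 2 / 3) * (1 - Rstar) * W"
      using \<alpha> by (simp add: \<Lambda>_def l_def field_simps)
    then have scaled: "\<alpha> * ((1 - R) * W - \<Lambda>) = W * (\<alpha> * (1 - R) - (\<alpha> - 2 / 3) * (1 - Rstar))"
      by (simp add: algebra_simps)
    have "R * W * (n - n * R / (4 * \<gamma>)) + (n - n * R / (2 * \<gamma>)) * (\<alpha> * ((1 - R) * W - \<Lambda>))
        = n * W * ((1 - R / (4 * \<gamma>)) * R
            + (1 - R / (2 * \<gamma>)) * (\<alpha> * (1 - R) - (\<alpha> - 2 / 3) * (1 - Rstar)))"
      unfolding scaled by (simp add: algebra_simps)
    moreover have "n * W * F_PMR \<gamma> Rstar \<le> \<dots>"
      using n W \<alpha> gamma R cond_iii by (intro mult_left_mono F_PMR_le) (auto simp: \<alpha>_def)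
    ultimately show ?thesis using P C by (simp add: n_def W_def)
  qed
qed

end
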